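(* Let $\mathcal K=(D,\varsigma)$ be a selective knowledge base and let $\mathbf U$ be a $\mathcal K$-unit. Then there exists an explanation $\varphi\in\mathbb{NXL}$ that characterizes $\mathbf U$ (with respect to $\mathcal K$).
   Context: **Structures.** Fix pairwise disjoint countably infinite sets $\mathsf P$ (predicates), $\mathsf C$ (constants), $\mathsf V$ (variables). Constants and variables are terms. Each predicate has a positive arity; $\mathsf P$ contains a special unary predicate $\top$. An atom is $p(t_1,\dots,t_k)$ with $p$ a predicate of arity $k$ and $t_i$ terms. A structure is a set of atoms; its domain $\mathbb D_S$ is the set of terms occurring in its atoms. $S$ is closed under $\top$ if $\top(t)\in S$ for all $t\in\mathbb D_S$. $S$ is connected if $|S|=1$ or $S$ can be partitioned into two connected structures $S',S''$ with $\mathbb D_{S'}\cap\mathbb D_{S''}\ne\emptyset$. For a set $T$ of terms, a $T$-homomorphism from $S$ to $S'$ is a total map $h:\mathbb D_S\to\mathbb D_{S'}$ with $h(t)=t$ for $t\in T\cap\mathbb D_S$ and such that $p(t_1,\dots,t_k)\in S$ implies $p(h(t_1),\dots,h(t_k))\in S'$. **Selective knowledge bases and units.** A dataset is a finite nonempty structure $D$ closed under $\top$ with $\mathbb D_D\subset\mathsf C$. A summary selector $\varsigma$ is a computable function mapping a dataset $D$ and a tuple $\tau$ of constants from $\mathbb D_D$ to a dataset $\varsigma(D,\tau)\subseteq D$ (written $\varsigma(\tau)$) whose domain contains all constants of $\tau$. A selective knowledge base (SKB) is a pair $\mathcal K=(D,\varsigma)$. An $n$-ary unit is a finite nonempty set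 $\mathbf U$ of $n$-ary tuples of constants, $n>0$, that is proper: there are no $i\neq j$ with $\tau[i]=\tau[j]$ for all $\tau\in\mathbf U$. It is a $\mathcal K$-unit if all its constants belong to $\mathbb D_D$. **Formulas.** A formula $\varphi$ of arity $n\ge0$ is an expression $x_1,\dots,x_n\leftarrow p_1(\mathbf t_1),\dots,p_m(\mathbf t_m)$ with $m>0$, each $p_i(\mathbf t_i)$ an atom and each $x_j$ a variable (called free) occurring in some of these atoms; $\mathit{atm}(\varphi)$ is its set of atoms. $\varphi$ is open if $n\geq1$. An open $\varphi$ is nearly connected if $\mathit{atm}(\varphi)\cup\{\mathsf{free}(x_1,\dots,x_n)\}$ is connected, with $\mathsf{free}$ a fresh predicate. $\mathbb{NXL}$ is the set of nearly connected open formulas; its elements are called explanations. The output $\varphi(D)$ over a dataset $D$ is the set of tuples $\langle t_1,\dots,t_n\rangle$ for which there is a $\mathsf C$-homomorphism $h$ from $\mathit{atm}(\varphi)$ to $D$ with $h(x_i)=t_i$ for all $i$. For $\mathcal K=(D,\varsigma)$, $\mathit{inst}(\varphi,\mathcal K)$ is the set of tuples $\tau$ (over $\mathbb D_D$) with $\tau\in\varphi(\varsigma(\tau))$. **Characterizations.** For formulas $\varphi_1,\varphi_2$ with free variables $x_1,\dots,x_n$ and $y_1,\dots,y_n$, write $\varphi_1\longrightarrow\varphi_2$ if there is a $\mathsf C$-homomorphism $h$ from $\mathit{atm}(\varphi_1)$ to $\mathit{atm}(\varphi_2)$ with $h(x_i)=y_i$ for all $i$. A formula $\varphi$ interprets $\mathbf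 U$ (w.r.t. $\mathcal K$) if $\varphi\in\mathbb{NXL}$ and $\mathit{inst}(\varphi,\mathcal K)\supseteq\mathbf U$. A formula $\varphi$ characterizes $\mathbf U$ if (i) $\varphi$ interprets $\mathbf U$, and (ii) for every $\varphi'$ that interprets $\mathbf U$, $\varphi\longrightarrow\varphi'$ implies $\varphi'\longrightarrow\varphi$. *)

theory Defs
  imports Main "HOL-Library.Nat_Bijection"
begin

text \<open>Constants, variables and predicates are three disjoint countably infinite sorts. The
  predicate symbol \<open>Top\<close> is the special unary predicate; arities are given by a function
  \<open>ar\<close>, over which everything below is parametric.\<close>

datatype trm = Const nat | Var nat

datatype predsym = Top | Pred nat

definition signature :: "(predsym \<Rightarrow> nat) \<Rightarrow> bool" where
  "signature ar \<longleftrightarrow> (\<forall>p. 0 < ar p) \<and> ar Top = 1"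

text \<open>Atoms are polymorphic in the predicate symbols, so that a fresh predicate can be added
  as \<open>None :: predsym option\<close>.\<close>

datatype 'p atom = Atom (psym: 'p) (args: "trm list")

abbreviation consts_set :: "trm set" where
  "consts_set \<equiv> range Const"

definition terms_of :: "'p atom set \<Rightarrow> trm set" where
  "terms_of S = (\<Union>a\<in>S. set (args a))"

definition respects_arity :: "('p \<Rightarrow> nat) \<Rightarrow> 'p atom set \<Rightarrow> bool" where
  "respects_arity ar S \<longleftrightarrow> (\<forall>a\<in>S. length (args a) = ar (psym a))"

definition closed_under_top :: "predsym atom set \<Rightarrow> bool" where
  "closed_under_top S \<longleftrightarrow> (\<forall>t\<in>terms_of S. Atom Top [t] \<in> S)"

inductive connected_structure :: "'p atom set \<Rightarrow> bool" where
  single: "connected_structure {a}"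
| union: "connected_structure S1 \<Longrightarrow> connected_structure S2 \<Longrightarrow> S1 \<inter> S2 = {} \<Longrightarrow>
    terms_of S1 \<inter> terms_of S2 \<noteq> {} \<Longrightarrow> connected_structure (S1 \<union> S2)"

definition homomorphism ::
    "trm set \<Rightarrow> 'p atom set \<Rightarrow> 'p atom set \<Rightarrow> (trm \<Rightarrow> trm) \<Rightarrow> bool" where
  "homomorphism T S S' h \<longleftrightarrow>
    h ` terms_of S \<subseteq> terms_of S' \<and>
    (\<forall>t\<in>T \<inter> terms_of S. h t = t) \<and>
    (\<forall>p ts. Atom p ts \<in> S \<longrightarrow> Atom p (map h ts) \<in> S')"

text \<open>Partial recursive functions on natural numbers. \<open>PrimRec f g\<close> recurses on its first
  argument; \<open>Mu f\<close> searches for the least first argument at which \<open>f\<close> vanishes, \<open>f\<close> being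
  defined at all smaller ones.\<close>

datatype recf = Zero | Succ | Proj nat | Comp recf "recf list" | PrimRec recf recf | Mu recf

inductive evaluates :: "recf \<Rightarrow> nat list \<Rightarrow> nat \<Rightarrow> bool" where
  "evaluates Zero xs 0"
| "evaluates Succ [x] (Suc x)"
| "i < length xs \<Longrightarrow> evaluates (Proj i) xs (xs ! i)"
| "list_all2 (\<lambda>g y. evaluates g xs y) gs ys \<Longrightarrow> evaluates f ys z \<Longrightarrow>
    evaluates (Comp f gs) xs z"
| "evaluates f xs y \<Longrightarrow> evaluates (PrimRec f g) (0 # xs) y"
| "evaluates (PrimRec f g) (k # xs) r \<Longrightarrow> evaluates g (k # r # xs) y \<Longrightarrow>
    evaluates (PrimRec f g) (Suc k # xs) y"
| "evaluates f (m # xs) 0 \<Longrightarrow> (\<forall>k<m. \<exists>y. evaluates f (k # xs) (Suc y)) \<Longrightarrow>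
    evaluates (Mu f) xs m"

fun trm_code :: "trm \<Rightarrow> nat" where
  "trm_code (Const n) = 2 * n"
| "trm_code (Var n) = 2 * n + 1"

fun predsym_code :: "predsym \<Rightarrow> nat" where
  "predsym_code Top = 0"
| "predsym_code (Pred n) = Suc n"

definition tuple_code :: "trm list \<Rightarrow> nat" where
  "tuple_code ts = list_encode (map trm_code ts)"

definition atom_code :: "predsym atom \<Rightarrow> nat" where
  "atom_code a = prod_encode (predsym_code (psym a), tuple_code (args a))"

text \<open>Only injective on finite structures, as \<^const>\<open>set_encode\<close> is \<open>0\<close> on infinite sets.\<close>

definition structure_code :: "predsym atom set \<Rightarrow> nat" where
  "structure_code S = set_encode (atom_code ` S)"

definition dataset :: "(predsym \<Rightarrow> nat) \<Rightarrow> predsym atom set \<Rightarrow> bool" where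
  "dataset ar D \<longleftrightarrow> finite D \<and> D \<noteq> {} \<and> respects_arity ar D \<and> closed_under_top D \<and>
    terms_of D \<subseteq> consts_set"

type_synonym selector = "predsym atom set \<Rightarrow> trm list \<Rightarrow> predsym atom set"

text \<open>A selector is a partial function defined on datasets \<open>D\<close> and tuples over the domain of
  \<open>D\<close>; its values on other arguments are irrelevant.\<close>

definition computable_selector :: "(predsym \<Rightarrow> nat) \<Rightarrow> selector \<Rightarrow> bool" where
  "computable_selector ar \<sigma> \<longleftrightarrow> (\<exists>f. \<forall>D \<tau>. dataset ar D \<longrightarrow> set \<tau> \<subseteq> terms_of D \<longrightarrow>
    evaluates f [structure_code D, tuple_code \<tau>] (structure_code (\<sigma> D \<tau>)))"

definition summary_selector :: "(predsym \<Rightarrow> nat) \<Rightarrow> selector \<Rightarrow> bool" where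
  "summary_selector ar \<sigma> \<longleftrightarrow> computable_selector ar \<sigma> \<and>
    (\<forall>D \<tau>. dataset ar D \<longrightarrow> set \<tau> \<subseteq> terms_of D \<longrightarrow>
      dataset ar (\<sigma> D \<tau>) \<and> \<sigma> D \<tau> \<subseteq> D \<and> set \<tau> \<subseteq> terms_of (\<sigma> D \<tau>))"

type_synonym skb = "predsym atom set \<times> selector"

definition selective_kb :: "(predsym \<Rightarrow> nat) \<Rightarrow> skb \<Rightarrow> bool" where
  "selective_kb ar K \<longleftrightarrow> dataset ar (fst K) \<and> summary_selector ar (snd K)"

definition proper :: "nat \<Rightarrow> trm list set \<Rightarrow> bool" where
  "proper n U \<longleftrightarrow> \<not> (\<exists>i<n. \<exists>j<n. i \<noteq> j \<and> (\<forall>\<tau>\<in>U. \<tau> ! i = \<tau> ! j))"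

definition is_unit :: "nat \<Rightarrow> trm list set \<Rightarrow> bool" where
  "is_unit n U \<longleftrightarrow> 0 < n \<and> finite U \<and> U \<noteq> {} \<and>
    (\<forall>\<tau>\<in>U. length \<tau> = n \<and> set \<tau> \<subseteq> consts_set) \<and> proper n U"

definition kb_unit :: "skb \<Rightarrow> nat \<Rightarrow> trm list set \<Rightarrow> bool" where
  "kb_unit K n U \<longleftrightarrow> is_unit n U \<and> (\<forall>\<tau>\<in>U. set \<tau> \<subseteq> terms_of (fst K))"

text \<open>\<open>Formula [x\<^sub>1, \<dots>, x\<^sub>n] [a\<^sub>1, \<dots>, a\<^sub>m]\<close> stands for \<open>x\<^sub>1, \<dots>, x\<^sub>n \<leftarrow> a\<^sub>1, \<dots>, a\<^sub>m\<close>; the free variables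
  are given by their indices.\<close>

datatype formula = Formula (head: "nat list") (body: "predsym atom list")

definition free_vars :: "formula \<Rightarrow> trm list" where
  "free_vars \<phi> = map Var (head \<phi>)"

definition atm :: "formula \<Rightarrow> predsym atom set" where
  "atm \<phi> = set (body \<phi>)"

definition wf_formula :: "(predsym \<Rightarrow> nat) \<Rightarrow> formula \<Rightarrow> bool" where
  "wf_formula ar \<phi> \<longleftrightarrow> body \<phi> \<noteq> [] \<and> respects_arity ar (atm \<phi>) \<and>
    set (free_vars \<phi>) \<subseteq> terms_of (atm \<phi>)"

definition open_formula :: "formula \<Rightarrow> bool" where
  "open_formula \<phi> \<longleftrightarrow> 1 \<le> length (head \<phi>)"

definition nearly_connected :: "formula \<Rightarrow> bool" where
  "nearly_connected \<phi> \<longleftrightarrow>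
    connected_structure (map_atom Some ` atm \<phi> \<union> {Atom None (free_vars \<phi>)})"

definition NXL :: "(predsym \<Rightarrow> nat) \<Rightarrow> formula set" where
  "NXL ar = {\<phi>. wf_formula ar \<phi> \<and> open_formula \<phi> \<and> nearly_connected \<phi>}"

definition formula_output :: "formula \<Rightarrow> predsym atom set \<Rightarrow> trm list set" where
  "formula_output \<phi> D = {map h (free_vars \<phi>) | h. homomorphism consts_set (atm \<phi>) D h}"

definition inst :: "formula \<Rightarrow> skb \<Rightarrow> trm list set" where
  "inst \<phi> K = {\<tau>. set \<tau> \<subseteq> terms_of (fst K) \<and> \<tau> \<in> formula_output \<phi> (snd K (fst K) \<tau>)}"

text \<open>The equation on free variables also forces both formulas to have the same arity.\<close>

definition maps_to :: "formula \<Rightarrow> formula \<Rightarrow> bool" where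
  "maps_to \<phi>1 \<phi>2 \<longleftrightarrow> (\<exists>h. homomorphism consts_set (atm \<phi>1) (atm \<phi>2) h \<and>
    map h (free_vars \<phi>1) = free_vars \<phi>2)"

definition interprets :: "(predsym \<Rightarrow> nat) \<Rightarrow> skb \<Rightarrow> formula \<Rightarrow> trm list set \<Rightarrow> bool" where
  "interprets ar K \<phi> U \<longleftrightarrow> \<phi> \<in> NXL ar \<and> U \<subseteq> inst \<phi> K"

definition characterizes :: "(predsym \<Rightarrow> nat) \<Rightarrow> skb \<Rightarrow> formula \<Rightarrow> trm list set \<Rightarrow> bool" where
  "characterizes ar K \<phi> U \<longleftrightarrow> interprets ar K \<phi> U \<and>
    (\<forall>\<phi>'. interprets ar K \<phi>' U \<longrightarrow> maps_to \<phi> \<phi>' \<longrightarrow> maps_to \<phi>' \<phi>)"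

end

(* The characterizing explanation is the nearly connected component of the direct product of the
   summaries of the tuples of U. Elements of the product become variables, and in addition every
   constant c of the dataset is kept as a second copy of the diagonal element (c, ..., c), so that
   free variables remain variables even where U is constant. An interpreting formula comes with one
   homomorphism per tuple of U; pairing them maps it into the product, and nearly connectedness
   forces the image into the component. So all interpreting formulas map to this one. *)
theory Submission
  imports Defs "HOL-Library.FuncSet"
begin

section \<open>Terms, homomorphisms and connected components\<close>

lemma terms_of_insert [simp]: "terms_of (insert a S) = set (args a) \<union> terms_of S"
  by (simp add: terms_of_def)

lemma terms_of_Un [simp]: "terms_of (S \<union> S') = terms_of S \<union> terms_of S'"
  by (simp add: terms_of_def)

lemma terms_of_empty [simp]: "terms_of {} = {}"
  by (simp add: terms_of_def)

lemma set_args_subset_terms_of: "a \<in> S \<Longrightarrow> set (args a) \<subseteq> terms_of S"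
  by (auto simp: terms_of_def)

lemma terms_of_mono: "S \<subseteq> S' \<Longrightarrow> terms_of S \<subseteq> terms_of S'"
  by (auto simp: terms_of_def)

text \<open>Every term of \<open>S\<close> occurs in an atom of \<open>S\<close>, so preservation of
  atoms already carries terms to terms.\<close>

lemma homomorphismI:
  assumes fix_consts: "\<And>t. t \<in> T \<Longrightarrow> t \<in> terms_of S \<Longrightarrow> h t = t"
    and atoms: "\<And>p ts. Atom p ts \<in> S \<Longrightarrow> Atom p (map h ts) \<in> S'"
  shows "homomorphism T S S' h"
proof -
  have "h t \<in> terms_of S'" if "t \<in> terms_of S" for t
  proof -
    from that obtain p ts where a: "Atom p ts \<in> S" "t \<in> set ts"
      unfolding terms_of_def by (metis UN_E atom.collapse)
    then show ?thesis
      using set_args_subset_terms_of[OF atoms[OF a(1)]] by auto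
  qed
  then show ?thesis
    using assms by (auto simp: homomorphism_def)
qed

text \<open>Induction on connectedness: the half whose image meets \<open>C\<close> is absorbed by
  \<open>C\<close>, hence so is the image of a term shared by both halves, and then the other half
  meets \<open>C\<close> as well.\<close>

lemma connected_image_subset:
  fixes S :: "'p atom set"
  assumes "connected_structure S"
    and closed: "\<And>a. a \<in> B \<Longrightarrow> set (args a) \<inter> terms_of C \<noteq> {} \<Longrightarrow> a \<in> C"
    and "\<And>p ts. Atom p ts \<in> S \<Longrightarrow> Atom p (map h ts) \<in> B"
    and "h ` terms_of S \<inter> terms_of C \<noteq> {}"
    and "Atom p ts \<in> S"
  shows "Atom p (map h ts) \<in> C"
  using assms(1,3-)
proof (induction arbitrary: p ts rule: connected_structure.induct)
  case (single a)
  have "a = Atom p ts" using single by simp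
  then show ?case using single closed by auto
next
  case (union S1 S2)
  have image_in: "h ` terms_of S' \<subseteq> terms_of C"
    if "\<And>p ts. Atom p ts \<in> S' \<Longrightarrow> Atom p (map h ts) \<in> C" for S' :: "'p atom set"
  proof
    fix u assume "u \<in> h ` terms_of S'"
    then obtain q us where a: "Atom q us \<in> S'" "u \<in> h ` set us"
      unfolding terms_of_def by (metis (no_types, lifting) UN_E atom.collapse image_iff)
    show "u \<in> terms_of C"
      using set_args_subset_terms_of[OF that[OF a(1)]] a(2) by auto
  qed
  have 1: "\<And>p ts. Atom p ts \<in> S1 \<Longrightarrow> Atom p (map h ts) \<in> C"
    if "h ` terms_of S1 \<inter> terms_of C \<noteq> {}"
    using union.IH(1) union.prems(1) that by blast
  have 2: "\<And>p ts. Atom p ts \<in> S2 \<Longrightarrow> Atom p (map h ts) \<in> C"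
    if "h ` terms_of S2 \<inter> terms_of C \<noteq> {}"
    using union.IH(2) union.prems(1) that by blast
  obtain t where t: "t \<in> terms_of S1" "t \<in> terms_of S2"
    using union.hyps by blast
  have "h ` terms_of S1 \<inter> terms_of C \<noteq> {} \<or> h ` terms_of S2 \<inter> terms_of C \<noteq> {}"
    using union.prems(2) by auto
  then have "h t \<in> terms_of C"
  proof
    assume "h ` terms_of S1 \<inter> terms_of C \<noteq> {}"
    from image_in[OF 1[OF this]] t show ?thesis by blast
  next
    assume "h ` terms_of S2 \<inter> terms_of C \<noteq> {}"
    from image_in[OF 2[OF this]] t show ?thesis by blast
  qed
  with t 1 2 union.prems(3) show ?case by blast
qed

text \<open>Take a maximal connected subset of \<open>B\<close> containing \<open>r\<close>. An
  outside atom sharing a term with it could be joined to it as a singleton, against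
  maximality.\<close>

lemma component_exists:
  assumes "finite B" and "r \<in> B"
  obtains C where "connected_structure C" "C \<subseteq> B" "r \<in> C"
    "\<And>a. a \<in> B \<Longrightarrow> set (args a) \<inter> terms_of C \<noteq> {} \<Longrightarrow> a \<in> C"
proof -
  define X where "X = {C. connected_structure C \<and> C \<subseteq> B \<and> r \<in> C}"
  have "finite X" using assms(1) by (simp add: X_def)
  moreover have "{r} \<in> X" using assms(2) by (simp add: X_def single)
  ultimately have "\<exists>C\<in>X. {r} \<subseteq> C \<and> (\<forall>C'\<in>X. C \<subseteq> C' \<longrightarrow> C = C')"
    by (rule finite_has_maximal2)
  then obtain C where "C \<in> X" and max: "\<And>C'. C' \<in> X \<Longrightarrow> C \<subseteq> C' \<Longrightarrow> C' = C"
    by metis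
  then have C: "connected_structure C" "C \<subseteq> B" "r \<in> C" by (simp_all add: X_def)
  have "a \<in> C" if a: "a \<in> B" "set (args a) \<inter> terms_of C \<noteq> {}" for a
  proof (rule ccontr)
    assume "a \<notin> C"
    then have "connected_structure (C \<union> {a})"
      using C a(2) by (intro connected_structure.union single) auto
    then have "C \<union> {a} = C" using C a(1) by (intro max) (auto simp: X_def)
    with \<open>a \<notin> C\<close> show False by blast
  qed
  with C show thesis by (rule that)
qed

lemma interprets_homomorphism:
  assumes "interprets ar K \<phi> U" and "\<tau> \<in> U"
  obtains h where "homomorphism consts_set (atm \<phi>) (snd K (fst K) \<tau>) h"
    "map h (free_vars \<phi>) = \<tau>"
  using assms by (auto simp: interprets_def inst_def formula_output_def subset_iff)

text \<open>Being terminal with respect to \<open>maps_to\<close> among the interpreting formulas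
  yields condition (ii) of a characterization at once.\<close>

lemma terminal_explanation_exists:
  assumes "selective_kb ar K" and "kb_unit K n U"
  obtains \<phi> where "interprets ar K \<phi> U"
    "\<And>\<phi>'. interprets ar K \<phi>' U \<Longrightarrow> maps_to \<phi>' \<phi>"
proof -
  define D where "D = fst K"
  define s where "s \<tau> = snd K D \<tau>" for \<tau>
  have D: "finite D" "respects_arity ar D" "terms_of D \<subseteq> consts_set"
    using assms(1) by (auto simp: selective_kb_def dataset_def D_def)
  have U: "0 < n" "finite U" "U \<noteq> {}" "\<And>\<tau>. \<tau> \<in> U \<Longrightarrow> length \<tau> = n"
    "\<And>\<tau>. \<tau> \<in> U \<Longrightarrow> set \<tau> \<subseteq> terms_of D"
    using assms(2) by (auto simp: kb_unit_def is_unit_def D_def)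
  have s: "s \<tau> \<subseteq> D" "set \<tau> \<subseteq> terms_of (s \<tau>)" "closed_under_top (s \<tau>)" if "\<tau> \<in> U" for \<tau>
    using assms(1) U(5)[OF that]
    by (auto simp: selective_kb_def summary_selector_def s_def D_def dataset_def)
  have finite_terms: "finite (terms_of D)" using D(1) by (simp add: terms_of_def)

  \<comment> \<open>The direct product of the summaries\<close>
  define F where "F = U \<rightarrow>\<^sub>E terms_of D"
  have "finite F" unfolding F_def by (intro finite_PiE U(2) finite_terms)
  \<comment> \<open>Product elements are extensional functions on the finite set \<open>U\<close>,
    so there are finitely many and each gets its own variable index.\<close>
  then obtain enc :: "(trm list \<Rightarrow> trm) \<Rightarrow> nat" where enc: "inj_on enc F"
    using finite_imp_inj_to_nat_seg by blast
  define e where "e \<tau> t = (case t of Const c \<Rightarrow> Const c | Var m \<Rightarrow> inv_into F enc m \<tau>)" for \<tau> t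
  have e_Const: "e \<tau> (Const c) = Const c" for \<tau> c by (simp add: e_def)
  have e_Var: "e \<tau> (Var (enc v)) = v \<tau>" if "v \<in> F" for \<tau> v
    using enc that by (simp add: e_def)

  \<comment> \<open>The constants are there to receive the constants of an interpreting formula,
    which homomorphisms must fix.\<close>
  define T where "T = terms_of D \<union> (\<lambda>v. Var (enc v)) ` F"
  \<comment> \<open>The largest set of atoms over \<open>T\<close> for which every projection
    \<open>e \<tau>\<close> sends atoms into the summary \<open>s \<tau>\<close>.\<close>
  define A where "A = {a. set (args a) \<subseteq> T \<and>
    (\<forall>\<tau>\<in>U. Atom (psym a) (map (e \<tau>) (args a)) \<in> s \<tau>)}"
  \<comment> \<open>Projecting along any one tuple of \<open>U\<close> bounds the predicates and
    arities of \<open>A\<close> by those of \<open>D\<close>; both the arity condition and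
    finiteness come from this.\<close>
  have A_D: "\<exists>us. Atom p us \<in> D \<and> length us = length ts" if "Atom p ts \<in> A" for p ts
  proof -
    obtain \<tau> where \<tau>: "\<tau> \<in> U" using U(3) by blast
    then have "Atom p (map (e \<tau>) ts) \<in> D" using that s(1)[OF \<tau>] by (auto simp: A_def)
    then show ?thesis by (metis length_map)
  qed
  have arity_A: "respects_arity ar A"
  proof -
    have "length (args a) = ar (psym a)" if "a \<in> A" for a
      using A_D[of "psym a" "args a"] that D(2) by (force simp: respects_arity_def)
    then show ?thesis by (simp add: respects_arity_def)
  qed
  have "finite A"
  proof (rule finite_subset)
    show "A \<subseteq> (\<Union>p\<in>psym ` D. Atom p ` {ts. set ts \<subseteq> T \<and> length ts = ar p})"
    proof
      fix a assume a: "a \<in> A"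
      obtain p ts where a_eq: "a = Atom p ts" by (cases a)
      have "p \<in> psym ` D" using A_D a a_eq by force
      moreover have "set ts \<subseteq> T" using a a_eq by (simp add: A_def)
      moreover have "length ts = ar p" using arity_A a a_eq by (auto simp: respects_arity_def)
      ultimately show "a \<in> (\<Union>p\<in>psym ` D. Atom p ` {ts. set ts \<subseteq> T \<and> length ts = ar p})"
        using a_eq by blast
    qed
    have "finite T" using finite_terms \<open>finite F\<close> by (simp add: T_def)
    then show "finite (\<Union>p\<in>psym ` D. Atom p ` {ts. set ts \<subseteq> T \<and> length ts = ar p})"
      using D(1) by (intro finite_UN_I finite_imageI finite_lists_length_eq) auto
  qed

  \<comment> \<open>The tuple of free variables\<close>
  define w where "w i = (\<lambda>\<tau>\<in>U. \<tau> ! i)" for i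
  have w: "w i \<in> F" if "i < n" for i
    using U(4,5) that nth_mem by (fastforce simp: F_def w_def)
  \<comment> \<open>The i-th free variable names the product element with coordinate
    \<open>\<tau> ! i\<close> at \<open>\<tau>\<close>, so projecting the head to
    \<open>\<tau>\<close> returns \<open>\<tau>\<close> itself.\<close>
  define hd where "hd = map (\<lambda>i. enc (w i)) [0..<n]"
  have e_hd: "map (e \<tau>) (map Var hd) = \<tau>" if "\<tau> \<in> U" for \<tau>
    using U(4)[OF that] that by (intro nth_equalityI) (auto simp: hd_def e_Var w, simp add: w_def)
  \<comment> \<open>Closure of the summaries under \<open>Top\<close> guarantees that each free
    variable occurs in some atom of the product.\<close>
  have Top_A: "Atom Top [x] \<in> A" if x: "x \<in> set (map Var hd)" for x
  proof -
    obtain i where i: "i < n" "x = Var (enc (w i))" using x by (auto simp: hd_def)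
    have "Atom Top [e \<tau> x] \<in> s \<tau>" if \<tau>: "\<tau> \<in> U" for \<tau>
    proof -
      have "e \<tau> x = \<tau> ! i" using i w[OF i(1)] \<tau> by (simp add: e_Var w_def)
      then have "e \<tau> x \<in> terms_of (s \<tau>)" using s(2)[OF \<tau>] U(4)[OF \<tau>] i(1) nth_mem by fastforce
      then show ?thesis using s(3)[OF \<tau>] by (simp add: closed_under_top_def)
    qed
    moreover have "x \<in> T" using i w by (auto simp: T_def)
    ultimately show ?thesis by (simp add: A_def)
  qed

  \<comment> \<open>The component of the free variables\<close>
  define root where "root = (Atom None (map Var hd) :: predsym option atom)"
  \<comment> \<open>With the fresh atom \<open>root\<close> added, the component of
    \<open>root\<close> is connected, which is near connectedness once \<open>root\<close> is
    removed again.\<close>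
  define B where "B = insert root (map_atom Some ` A)"
  have "finite B" "root \<in> B" using \<open>finite A\<close> by (simp_all add: B_def)
  then obtain C where C: "connected_structure C" "C \<subseteq> B" "root \<in> C"
    and closed: "\<And>a. a \<in> B \<Longrightarrow> set (args a) \<inter> terms_of C \<noteq> {} \<Longrightarrow> a \<in> C"
    using component_exists by metis
  define A' where "A' = {a \<in> A. map_atom Some a \<in> C}"
  have C_eq: "C = map_atom Some ` A' \<union> {root}"
    using C(2,3) by (auto simp: A'_def B_def)
  have "finite A'" using \<open>finite A\<close> by (simp add: A'_def)
  then obtain as where as: "set as = A'" using finite_list by blast
  define \<phi> where "\<phi> = Formula hd as"
  have atm_\<phi>: "atm \<phi> = A'" and free_\<phi>: "free_vars \<phi> = map Var hd"
    by (simp_all add: \<phi>_def atm_def free_vars_def as)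
  have root_terms: "set (map Var hd) \<subseteq> terms_of C"
    using set_args_subset_terms_of[OF C(3)] by (simp add: root_def)
  have Top_A': "Atom Top [x] \<in> A'" if x: "x \<in> set (map Var hd)" for x
  proof -
    \<comment> \<open>This atom shares \<open>x\<close> with \<open>root\<close>.\<close>
    have "Atom (Some Top) [x] \<in> C"
      by (rule closed) (use Top_A[OF x] root_terms x in \<open>force simp: B_def\<close>)+
    then show ?thesis using Top_A[OF x] by (simp add: A'_def)
  qed
  have hd_ne: "hd \<noteq> []" using U(1) by (simp add: hd_def)

  \<comment> \<open>The component is an explanation that interprets the unit\<close>
  have "wf_formula ar \<phi>"
  proof -
    have "A' \<noteq> {}" using Top_A' hd_ne by (cases hd) auto
    moreover have "respects_arity ar A'" using arity_A by (auto simp: respects_arity_def A'_def)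
    moreover have "set (map Var hd) \<subseteq> terms_of A'"
      using set_args_subset_terms_of[OF Top_A'] by auto
    ultimately show ?thesis
      using as by (auto simp: wf_formula_def atm_\<phi> free_\<phi>) (auto simp: \<phi>_def)
  qed
  moreover have "open_formula \<phi>" using U(1) by (simp add: open_formula_def \<phi>_def hd_def)
  moreover have "nearly_connected \<phi>"
    using C(1) unfolding nearly_connected_def atm_\<phi> free_\<phi> C_eq root_def .
  ultimately have NXL: "\<phi> \<in> NXL ar" by (simp add: NXL_def)
  have "\<tau> \<in> inst \<phi> K" if \<tau>: "\<tau> \<in> U" for \<tau>
  proof -
    \<comment> \<open>The projection to \<open>\<tau>\<close> is the homomorphism witnessing the
      output \<open>\<tau>\<close>.\<close>
    have "homomorphism consts_set A' (s \<tau>) (e \<tau>)"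
      using \<tau> by (intro homomorphismI) (auto simp: e_Const A'_def A_def)
    then have "\<tau> \<in> formula_output \<phi> (s \<tau>)"
      unfolding formula_output_def atm_\<phi> free_\<phi> using e_hd[OF \<tau>]
      by (metis (mono_tags, lifting) mem_Collect_eq)
    then show ?thesis using U(5)[OF \<tau>] by (simp add: inst_def s_def D_def)
  qed
  with NXL have interprets: "interprets ar K \<phi> U" by (auto simp: interprets_def)

  \<comment> \<open>Pairing the homomorphisms of an interpreting formula\<close>
  have "maps_to \<phi>' \<phi>" if \<phi>': "interprets ar K \<phi>' U" for \<phi>'
  proof -
    let ?S = "map_atom Some ` atm \<phi>' \<union> {Atom None (free_vars \<phi>')}"
    have \<phi>'_NXL: "wf_formula ar \<phi>'" "connected_structure ?S"
      using \<phi>' by (auto simp: interprets_def NXL_def nearly_connected_def)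
    have "\<forall>\<tau>\<in>U. \<exists>h. homomorphism consts_set (atm \<phi>') (s \<tau>) h \<and> map h (free_vars \<phi>') = \<tau>"
      using interprets_homomorphism[OF \<phi>'] unfolding s_def D_def by metis
    then obtain g where g: "\<And>\<tau>. \<tau> \<in> U \<Longrightarrow> homomorphism consts_set (atm \<phi>') (s \<tau>) (g \<tau>)"
      and g_free: "\<And>\<tau>. \<tau> \<in> U \<Longrightarrow> map (g \<tau>) (free_vars \<phi>') = \<tau>"
      by metis
    define v where "v t = (\<lambda>\<tau>\<in>U. g \<tau> t)" for t
    \<comment> \<open>Variables go to product elements even when \<open>v t\<close> is constant on
      \<open>U\<close>; only constants use the second copy of the diagonal.\<close>
    define h where "h t = (case t of Const c \<Rightarrow> Const c | Var m \<Rightarrow> Var (enc (v t)))" for t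
    have g_in: "g \<tau> t \<in> terms_of D" if "\<tau> \<in> U" "t \<in> terms_of (atm \<phi>')" for \<tau> t
      using g[OF that(1)] that(2) terms_of_mono[OF s(1)[OF that(1)]]
      by (auto simp: homomorphism_def)
    have g_const: "g \<tau> (Const c) = Const c" if "\<tau> \<in> U" "Const c \<in> terms_of (atm \<phi>')" for \<tau> c
      using g[OF that(1)] that(2) by (auto simp: homomorphism_def)
    have v: "v t \<in> F" if "t \<in> terms_of (atm \<phi>')" for t
      using g_in that by (auto simp: v_def F_def)
    have h_T: "h t \<in> T" if t: "t \<in> terms_of (atm \<phi>')" for t
    proof (cases t)
      case (Const c)
      \<comment> \<open>Since \<open>g \<tau>\<close> fixes \<open>c\<close> and maps into
        \<open>D\<close>, the constant \<open>c\<close> belongs to \<open>D\<close>.\<close>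
      obtain \<tau> where "\<tau> \<in> U" using U(3) by blast
      with Const g_in g_const t show ?thesis by (fastforce simp: T_def h_def)
    next
      case (Var m)
      with v[OF t] show ?thesis by (simp add: T_def h_def)
    qed
    \<comment> \<open>The universal property of the product: projecting the pairing gives back its
      coordinates.\<close>
    have e_h: "e \<tau> (h t) = g \<tau> t" if "t \<in> terms_of (atm \<phi>')" "\<tau> \<in> U" for t \<tau>
      using that v[OF that(1)] by (cases t) (auto simp: h_def e_Const e_Var g_const v_def)
    have h_A: "Atom p (map h ts) \<in> A" if a: "Atom p ts \<in> atm \<phi>'" for p ts
    proof -
      have ts: "set ts \<subseteq> terms_of (atm \<phi>')" using set_args_subset_terms_of[OF a] by simp
      have "Atom p (map (e \<tau>) (map h ts)) \<in> s \<tau>" if \<tau>: "\<tau> \<in> U" for \<tau>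
      proof -
        have "map (e \<tau>) (map h ts) = map (g \<tau>) ts" using e_h[OF _ \<tau>] ts by auto
        then show ?thesis using g[OF \<tau>] a unfolding homomorphism_def by metis
      qed
      then show ?thesis using h_T ts by (auto simp: A_def)
    qed
    have free_len: "length (free_vars \<phi>') = n"
      using g_free U(3,4) by (metis length_map all_not_in_conv)
    have h_free: "map h (free_vars \<phi>') = map Var hd"
    proof (rule nth_equalityI)
      show "length (map h (free_vars \<phi>')) = length (map Var hd)" by (simp add: free_len hd_def)
      fix i assume "i < length (map h (free_vars \<phi>'))"
      then have i: "i < n" by (simp add: free_len)
      have "g \<tau> (free_vars \<phi>' ! i) = \<tau> ! i" if "\<tau> \<in> U" for \<tau>
        using g_free[OF that] i free_len by (metis nth_map)
      \<comment> \<open>Both sides are extensional, so agreement on \<open>U\<close> makes them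
        equal.\<close>
      then have "v (free_vars \<phi>' ! i) = w i" by (auto simp: v_def w_def)
      then show "map h (free_vars \<phi>') ! i = map Var hd ! i"
        using i free_len by (auto simp: h_def hd_def free_vars_def)
    qed
    have h_B: "Atom p (map h ts) \<in> B" if "Atom p ts \<in> ?S" for p ts
    proof -
      from that consider "p = None" "ts = free_vars \<phi>'"
        | q where "p = Some q" "Atom q ts \<in> atm \<phi>'"
        by (auto simp: image_iff) (metis atom.exhaust atom.map atom.inject)
      then show ?thesis
      proof cases
        case 1
        then show ?thesis by (simp add: B_def root_def h_free)
      next
        case 2
        with h_A[OF 2(2)] show ?thesis by (force simp: B_def)
      qed
    qed
    \<comment> \<open>The image of the fresh atom is \<open>root\<close>, and \<open>n > 0\<close>
      gives \<open>root\<close> at least one argument.\<close>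
    have meets: "h ` terms_of ?S \<inter> terms_of C \<noteq> {}"
    proof -
      have "set (map Var hd) \<subseteq> h ` terms_of ?S"
        by (subst h_free[symmetric]) auto
      with root_terms hd_ne show ?thesis by (cases hd) auto
    qed
    have "Atom p (map h ts) \<in> A'" if a: "Atom p ts \<in> atm \<phi>'" for p ts
    proof -
      \<comment> \<open>Near connectedness of \<open>\<phi>'\<close> now forces the whole image into
        the component.\<close>
      have "Atom (Some p) (map h ts) \<in> C"
      proof (rule connected_image_subset[OF \<phi>'_NXL(2) closed h_B meets])
        show "Atom (Some p) ts \<in> ?S" using a by force
      qed
      then show ?thesis using h_A[OF a] by (simp add: A'_def)
    qed
    then have "homomorphism consts_set (atm \<phi>') (atm \<phi>) h"
      unfolding atm_\<phi> by (intro homomorphismI) (auto simp: h_def)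
    then show ?thesis
      using h_free unfolding maps_to_def free_\<phi> by blast
  qed
  with interprets that show thesis by blast
qed

theorem theorem1:
  fixes ar :: "predsym \<Rightarrow> nat" and K :: skb and n :: nat and U :: "trm list set"
  assumes "signature ar"
    and "selective_kb ar K"
    and "kb_unit K n U"
  shows "\<exists>\<phi>\<in>NXL ar. characterizes ar K \<phi> U"
proof -
  obtain \<phi> where \<phi>: "interprets ar K \<phi> U"
    "\<And>\<phi>'. interprets ar K \<phi>' U \<Longrightarrow> maps_to \<phi>' \<phi>"
    by (rule terminal_explanation_exists[OF assms(2,3)]) blast
  then show ?thesis by (auto simp: characterizes_def interprets_def)
qed

end
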